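(* Suppose that $\varphi$ is a constant selfmap of the open unit disk $\mathbb{D}$, and consider $C_\varphi:H^2\to H^2$. Then the following are equivalent: (1) $C_\varphi$ is posinormal; (2) $C_\varphi$ is coposinormal; (3) $C_\varphi$ is self-adjoint; (4) $\varphi=0$.
   Context: $H^2$ is the Hilbert space of analytic functions $f(z)=\sum_{n\ge 0}a_nz^n$ on $\mathbb{D}$ with $\|f\|^2=\sum|a_n|^2<\infty$, and $C_\varphi f=f\circ\varphi$ (bounded on $H^2$). A bounded linear operator $A$ on a Hilbert space is posinormal if there is a positive operator $P$ with $AA^*=A^*PA$ (equivalently, $\operatorname{ran}A\subseteq\operatorname{ran}A^*$); $A$ is coposinormal if $A^*$ is posinormal. *)

theory Defs
  imports "HOL-Complex_Analysis.Complex_Analysis"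
begin

section \<open>Operators on complex Hilbert spaces\<close>

text \<open>
  The inner product is linear in its first argument. The real structure is the one underlying the
  complex structure, so the norm is \<open>norm x = sqrt (Re (cinner x x))\<close>.
\<close>

class complex_hilbert_space = real_inner + complete_space +
  fixes scaleC :: "complex \<Rightarrow> 'a \<Rightarrow> 'a" (infixr "*\<^sub>C" 75)
    and cinner :: "'a \<Rightarrow> 'a \<Rightarrow> complex"
  assumes scaleC_add_right: "c *\<^sub>C (x + y) = c *\<^sub>C x + c *\<^sub>C y"
    and scaleC_add_left: "(c + d) *\<^sub>C x = c *\<^sub>C x + d *\<^sub>C x"
    and scaleC_scaleC: "c *\<^sub>C d *\<^sub>C x = (c * d) *\<^sub>C x"
    and scaleC_one: "1 *\<^sub>C x = x"
    and scaleR_scaleC: "r *\<^sub>R x = of_real r *\<^sub>C x"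
    and cinner_commute: "cinner x y = cnj (cinner y x)"
    and cinner_add_left: "cinner (x + y) z = cinner x z + cinner y z"
    and cinner_scaleC_left: "cinner (c *\<^sub>C x) y = c * cinner x y"
    and inner_eq_Re_cinner: "inner x y = Re (cinner x y)"

definition bounded_clinear ::
    "('a::complex_hilbert_space \<Rightarrow> 'b::complex_hilbert_space) \<Rightarrow> bool" where
  "bounded_clinear A \<longleftrightarrow> bounded_linear A \<and> (\<forall>c x. A (c *\<^sub>C x) = c *\<^sub>C A x)"

text \<open>
  By the Riesz representation theorem the description below is satisfied by exactly one function
  whenever \<open>A\<close> is bounded and complex linear; for other \<open>A\<close> the adjoint is not meaningful.
\<close>

definition cadjoint ::
    "('a::complex_hilbert_space \<Rightarrow> 'b::complex_hilbert_space) \<Rightarrow> 'b \<Rightarrow> 'a" where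
  "cadjoint A = (THE B. \<forall>x y. cinner (A x) y = cinner x (B y))"

definition positive_operator :: "('a::complex_hilbert_space \<Rightarrow> 'a) \<Rightarrow> bool" where
  "positive_operator P \<longleftrightarrow> bounded_clinear P \<and> (\<forall>x. cinner (P x) x \<in> \<real>\<^sub>\<ge>\<^sub>0)"

definition self_adjoint :: "('a::complex_hilbert_space \<Rightarrow> 'a) \<Rightarrow> bool" where
  "self_adjoint A \<longleftrightarrow> bounded_clinear A \<and> cadjoint A = A"

definition posinormal :: "('a::complex_hilbert_space \<Rightarrow> 'a) \<Rightarrow> bool" where
  "posinormal A \<longleftrightarrow> bounded_clinear A \<and>
     (\<exists>P. positive_operator P \<and> A \<circ> cadjoint A = cadjoint A \<circ> P \<circ> A)"

definition coposinormal :: "('a::complex_hilbert_space \<Rightarrow> 'a) \<Rightarrow> bool" where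
  "coposinormal A \<longleftrightarrow> bounded_clinear A \<and> posinormal (cadjoint A)"

section \<open>The Hardy space of the unit disk\<close>

definition taylor_coeff :: "(complex \<Rightarrow> complex) \<Rightarrow> nat \<Rightarrow> complex" where
  "taylor_coeff f n = (deriv ^^ n) f 0 / fact n"

text \<open>
  Functions on the disk are represented by total functions vanishing outside it, so that equality of
  representatives is equality on the disk.
\<close>

definition hardy_functions :: "(complex \<Rightarrow> complex) set" where
  "hardy_functions = {f. f holomorphic_on ball 0 1 \<and> (\<forall>z. z \<notin> ball 0 1 \<longrightarrow> f z = 0) \<and>
     summable (\<lambda>n. (cmod (taylor_coeff f n))\<^sup>2)}"

definition power_series_on_disk :: "(nat \<Rightarrow> complex) \<Rightarrow> complex \<Rightarrow> complex" where
  "power_series_on_disk a z = (if z \<in> ball 0 1 then \<Sum>n. a n * z ^ n else 0)"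

lemma square_summable_power_series:
  assumes "summable (\<lambda>n. (cmod (a n))\<^sup>2)"
  shows "power_series_on_disk a \<in> hardy_functions"
    and "taylor_coeff (power_series_on_disk a) = a"
proof -
  have "(\<lambda>n. (cmod (a n))\<^sup>2) \<longlonglongrightarrow> 0"
    using assms by (rule summable_LIMSEQ_zero)
  then have "(\<lambda>n. sqrt ((cmod (a n))\<^sup>2)) \<longlonglongrightarrow> sqrt 0"
    by (rule tendsto_real_sqrt)
  then have "(\<lambda>n. cmod (a n)) \<longlonglongrightarrow> 0"
    by simp
  then have "a \<longlonglongrightarrow> 0"
    by (rule tendsto_norm_zero_cancel)
  then have "Bseq a"
    using convergent_imp_Bseq convergentI by blast
  then obtain K where K: "\<And>n. cmod (a n) \<le> K"
    unfolding Bseq_def by blast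
  have ser: "summable (\<lambda>n. a n * z ^ n)" if "cmod z < 1" for z
  proof (rule summable_comparison_test)
    show "summable (\<lambda>n. K * cmod z ^ n)"
      using that by (intro summable_mult summable_geometric) auto
    show "\<exists>N. \<forall>n\<ge>N. norm (a n * z ^ n) \<le> K * cmod z ^ n"
      using K by (auto simp: norm_mult norm_power intro!: mult_right_mono)
  qed
  have sums: "(\<lambda>n. a n * (z - 0) ^ n) sums power_series_on_disk a z" if "z \<in> ball 0 1" for z
    using ser[of z] that by (auto simp: power_series_on_disk_def)
  have hol: "power_series_on_disk a holomorphic_on ball 0 1"
    by (rule power_series_holomorphic[OF sums])
  have "summable (\<lambda>n. a n * (1/2 :: complex) ^ n)"
    by (rule ser) (simp add: norm_divide)
  then have "ereal (1/2) \<le> fps_conv_radius (Abs_fps a)"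
    using conv_radius_geI[of a "1/2 :: complex"]
    by (simp add: fps_conv_radius_def norm_divide)
  then have "fps_conv_radius (Abs_fps a) > 0"
    by (rule less_le_trans[rotated]) simp
  then have "eval_fps (Abs_fps a) has_fps_expansion Abs_fps a"
    by (rule eval_fps_has_fps_expansion)
  moreover have "eventually (\<lambda>z. eval_fps (Abs_fps a) z = power_series_on_disk a z) (nhds 0)"
  proof (rule eventually_mono)
    show "eventually (\<lambda>z. z \<in> ball (0::complex) 1) (nhds 0)"
      by (rule eventually_nhds_in_open) auto
  qed (auto simp: eval_fps_def power_series_on_disk_def)
  ultimately have "power_series_on_disk a has_fps_expansion Abs_fps a"
    using has_fps_expansion_cong by blast
  from fps_nth_fps_expansion[OF this]
  show coeff: "taylor_coeff (power_series_on_disk a) = a"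
    by (auto simp: taylor_coeff_def)
  show "power_series_on_disk a \<in> hardy_functions"
    using hol assms coeff by (auto simp: hardy_functions_def power_series_on_disk_def)
qed

lemma hardy_functions_eqI:
  assumes "f \<in> hardy_functions" "g \<in> hardy_functions" "taylor_coeff f = taylor_coeff g"
  shows "f = g"
proof
  fix z
  show "f z = g z"
  proof (cases "z \<in> ball 0 1")
    case True
    have "(\<lambda>n. taylor_coeff f n * z ^ n) sums f z" "(\<lambda>n. taylor_coeff g n * z ^ n) sums g z"
      using holomorphic_power_series[of f 0 1 z] holomorphic_power_series[of g 0 1 z] assms(1,2) True
      by (auto simp: hardy_functions_def taylor_coeff_def)
    then show ?thesis
      using assms(3) sums_unique2 by metis
  next
    case False
    then show ?thesis
      using assms by (auto simp: hardy_functions_def)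
  qed
qed

lemma square_summable_add:
  assumes "summable (\<lambda>n. (cmod (a n))\<^sup>2)" "summable (\<lambda>n. (cmod (b n))\<^sup>2)"
  shows "summable (\<lambda>n. (cmod (a n + b n))\<^sup>2)"
proof (rule summable_comparison_test)
  show "summable (\<lambda>n. 2 * (cmod (a n))\<^sup>2 + 2 * (cmod (b n))\<^sup>2)"
    using assms by (intro summable_add summable_mult)
  have "(cmod (x + y))\<^sup>2 \<le> 2 * (cmod x)\<^sup>2 + 2 * (cmod y)\<^sup>2" for x y
  proof -
    have "(cmod (x + y))\<^sup>2 \<le> (cmod x + cmod y)\<^sup>2"
      by (intro power_mono norm_triangle_ineq) auto
    also have "\<dots> \<le> 2 * (cmod x)\<^sup>2 + 2 * (cmod y)\<^sup>2"
      using sum_squares_bound[of "cmod x" "cmod y"] by (simp add: power2_sum)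
    finally show ?thesis .
  qed
  then show "\<exists>N. \<forall>n\<ge>N. norm ((cmod (a n + b n))\<^sup>2) \<le> 2 * (cmod (a n))\<^sup>2 + 2 * (cmod (b n))\<^sup>2"
    by auto
qed

lemma square_summable_mult:
  assumes "summable (\<lambda>n. (cmod (a n))\<^sup>2)"
  shows "summable (\<lambda>n. (cmod (c * a n))\<^sup>2)"
  using summable_mult[OF assms, of "(cmod c)\<^sup>2"] by (simp add: norm_mult power_mult_distrib)

lemma square_summable_product:
  assumes "summable (\<lambda>n. (cmod (a n))\<^sup>2)" "summable (\<lambda>n. (cmod (b n))\<^sup>2)"
  shows "summable (\<lambda>n. a n * cnj (b n))"
proof (rule summable_comparison_test)
  show "summable (\<lambda>n. (cmod (a n))\<^sup>2 + (cmod (b n))\<^sup>2)"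
    using assms by (rule summable_add)
  have "cmod x * cmod y \<le> (cmod x)\<^sup>2 + (cmod y)\<^sup>2" for x y
  proof -
    have "2 * cmod x * cmod y \<le> (cmod x)\<^sup>2 + (cmod y)\<^sup>2"
      by (rule sum_squares_bound)
    moreover have "0 \<le> cmod x * cmod y"
      by simp
    ultimately show ?thesis
      by linarith
  qed
  then show "\<exists>N. \<forall>n\<ge>N. norm (a n * cnj (b n)) \<le> (cmod (a n))\<^sup>2 + (cmod (b n))\<^sup>2"
    by (auto simp: norm_mult)
qed

lemma taylor_coeff_add:
  assumes "f \<in> hardy_functions" "g \<in> hardy_functions"
  shows "taylor_coeff (\<lambda>z. f z + g z) = (\<lambda>n. taylor_coeff f n + taylor_coeff g n)"
  using assms higher_deriv_add[of f "ball 0 1" g 0]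
  by (auto simp: hardy_functions_def taylor_coeff_def add_divide_distrib)

lemma taylor_coeff_mult:
  assumes "f \<in> hardy_functions"
  shows "taylor_coeff (\<lambda>z. c * f z) = (\<lambda>n. c * taylor_coeff f n)"
  using assms higher_deriv_cmult[of f "ball 0 1" 0 _ c]
  by (auto simp: hardy_functions_def taylor_coeff_def)

lemma hardy_functions_add:
  assumes "f \<in> hardy_functions" "g \<in> hardy_functions"
  shows "(\<lambda>z. f z + g z) \<in> hardy_functions"
  unfolding hardy_functions_def mem_Collect_eq taylor_coeff_add[OF assms]
  using assms square_summable_add by (auto simp: hardy_functions_def intro!: holomorphic_intros)

lemma hardy_functions_mult:
  assumes "f \<in> hardy_functions"
  shows "(\<lambda>z. c * f z) \<in> hardy_functions"
  unfolding hardy_functions_def mem_Collect_eq taylor_coeff_mult[OF assms]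
  using assms square_summable_mult by (auto simp: hardy_functions_def intro!: holomorphic_intros)

typedef hardy = hardy_functions
  morphisms hardy_fun Abs_hardy
  using square_summable_power_series(1)[of "\<lambda>_. 0"] by auto

definition hcoeff :: "hardy \<Rightarrow> nat \<Rightarrow> complex" where
  "hcoeff f = taylor_coeff (hardy_fun f)"

lemma square_summable_hcoeff: "summable (\<lambda>n. (cmod (hcoeff f n))\<^sup>2)"
  using hardy_fun[of f] by (auto simp: hcoeff_def hardy_functions_def)

lemma hardy_eqI: "hcoeff f = hcoeff g \<Longrightarrow> f = g"
  unfolding hcoeff_def using hardy_functions_eqI hardy_fun hardy_fun_inject by blast

lemma ex_hardy_hcoeff:
  assumes "summable (\<lambda>n. (cmod (a n))\<^sup>2)"
  shows "\<exists>f. hcoeff f = a"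
  using square_summable_power_series[OF assms] Abs_hardy_inverse unfolding hcoeff_def by metis

instantiation hardy :: real_inner
begin

definition zero_hardy :: hardy where
  "0 = Abs_hardy (\<lambda>z. 0)"

definition plus_hardy :: "hardy \<Rightarrow> hardy \<Rightarrow> hardy" where
  "f + g = Abs_hardy (\<lambda>z. hardy_fun f z + hardy_fun g z)"

definition scaleR_hardy :: "real \<Rightarrow> hardy \<Rightarrow> hardy" where
  "r *\<^sub>R f = Abs_hardy (\<lambda>z. of_real r * hardy_fun f z)"

definition uminus_hardy :: "hardy \<Rightarrow> hardy" where
  "- f = (-1) *\<^sub>R (f :: hardy)"

definition minus_hardy :: "hardy \<Rightarrow> hardy \<Rightarrow> hardy" where
  "f - g = f + - (g :: hardy)"

definition inner_hardy :: "hardy \<Rightarrow> hardy \<Rightarrow> real" where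
  "inner f g = Re (\<Sum>n. hcoeff f n * cnj (hcoeff g n))"

definition norm_hardy :: "hardy \<Rightarrow> real" where
  "norm f = sqrt (\<Sum>n. (cmod (hcoeff f n))\<^sup>2)"

definition dist_hardy :: "hardy \<Rightarrow> hardy \<Rightarrow> real" where
  "dist f g = norm (f - g :: hardy)"

definition sgn_hardy :: "hardy \<Rightarrow> hardy" where
  "sgn f = inverse (norm f) *\<^sub>R (f :: hardy)"

definition uniformity_hardy :: "(hardy \<times> hardy) filter" where
  "uniformity_hardy = (INF e\<in>{0 <..}. principal {(f, g). dist f g < e})"

definition open_hardy :: "hardy set \<Rightarrow> bool" where
  "open_hardy U \<longleftrightarrow> (\<forall>f\<in>U. eventually (\<lambda>(f', g). f' = f \<longrightarrow> g \<in> U) uniformity)"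

lemma hcoeff_add: "hcoeff (f + g) n = hcoeff f n + hcoeff g n"
  by (simp add: hcoeff_def plus_hardy_def Abs_hardy_inverse hardy_functions_add hardy_fun
      taylor_coeff_add)

lemma hcoeff_scaleR: "hcoeff (r *\<^sub>R f) n = of_real r * hcoeff f n"
  by (simp add: hcoeff_def scaleR_hardy_def Abs_hardy_inverse hardy_functions_mult hardy_fun
      taylor_coeff_mult)

lemma hcoeff_zero: "hcoeff 0 n = 0"
proof -
  have "0 = 0 *\<^sub>R (0 :: hardy)"
    by (simp add: zero_hardy_def scaleR_hardy_def)
  then show ?thesis
    by (metis hcoeff_scaleR mult_zero_left of_real_0)
qed

lemma hcoeff_uminus: "hcoeff (- f) n = - hcoeff f n"
  by (simp add: uminus_hardy_def hcoeff_scaleR)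

lemma hcoeff_minus: "hcoeff (f - g) n = hcoeff f n - hcoeff g n"
  by (simp add: minus_hardy_def hcoeff_add hcoeff_uminus)

lemmas hcoeff_simps =
  hcoeff_zero hcoeff_add hcoeff_uminus hcoeff_minus hcoeff_scaleR

lemma summable_hcoeff_product: "summable (\<lambda>n. hcoeff f n * cnj (hcoeff g n))"
  by (rule square_summable_product) (rule square_summable_hcoeff)+

lemma hardy_inner_self: "inner f f = (\<Sum>n. (cmod (hcoeff f n))\<^sup>2)" for f :: hardy
  unfolding inner_hardy_def
  using Re_suminf[OF summable_hcoeff_product[of f f]]
  by (simp add: complex_mult_cnj cmod_power2)

instance
proof
  fix f g h :: hardy and r s :: real
  show "f + g + h = f + (g + h)" "f + g = g + f" "0 + f = f" "- f + f = 0" "f - g = f + - g"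
    by (rule hardy_eqI, rule ext, simp add: hcoeff_simps)+
  show "r *\<^sub>R (f + g) = r *\<^sub>R f + r *\<^sub>R g" "(r + s) *\<^sub>R f = r *\<^sub>R f + s *\<^sub>R f"
    "r *\<^sub>R s *\<^sub>R f = (r * s) *\<^sub>R f" "1 *\<^sub>R f = f"
    by (rule hardy_eqI, rule ext, simp add: hcoeff_simps algebra_simps)+
  show "sgn f = inverse (norm f) *\<^sub>R f" "dist f g = norm (f - g)"
    by (simp_all add: sgn_hardy_def dist_hardy_def)
  show "(uniformity :: (hardy \<times> hardy) filter) = (INF e\<in>{0 <..}. principal {(f, g). dist f g < e})"
    by (rule uniformity_hardy_def)
  show "open U \<longleftrightarrow> (\<forall>f\<in>U. eventually (\<lambda>(f', g). f' = f \<longrightarrow> g \<in> U) uniformity)" for U :: "hardy set"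
    by (rule open_hardy_def)
  show "inner f g = inner g f"
    unfolding inner_hardy_def Re_suminf[OF summable_hcoeff_product]
    by (simp add: mult.commute)
  show "inner (f + g) h = inner f h + inner g h"
    by (simp add: inner_hardy_def hcoeff_simps distrib_right summable_hcoeff_product
        suminf_add[symmetric])
  show "inner (r *\<^sub>R f) g = r * inner f g"
    by (simp add: inner_hardy_def hcoeff_simps mult.assoc summable_hcoeff_product suminf_mult)
  show "0 \<le> inner f f"
    by (simp add: hardy_inner_self suminf_nonneg square_summable_hcoeff)
  show "inner f f = 0 \<longleftrightarrow> f = 0"
    using suminf_eq_zero_iff[OF square_summable_hcoeff[of f]]
    by (auto simp: hardy_inner_self hcoeff_simps intro!: hardy_eqI)
  show "norm f = sqrt (inner f f)"
    by (simp add: norm_hardy_def hardy_inner_self)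
qed

end

instance hardy :: complete_space
proof
  show "convergent X" if "Cauchy X" for X :: "nat \<Rightarrow> hardy"
  proof -
    have dist: "dist f g = sqrt (\<Sum>n. (cmod (hcoeff f n - hcoeff g n))\<^sup>2)" for f g :: hardy
      by (simp add: dist_hardy_def norm_hardy_def hcoeff_simps)
    have sumdiff: "summable (\<lambda>n. (cmod (hcoeff f n - hcoeff g n))\<^sup>2)" for f g :: hardy
      using square_summable_hcoeff[of "f - g"] by (simp add: hcoeff_simps)
    have part: "(\<Sum>n\<in>F. (cmod (hcoeff f n - hcoeff g n))\<^sup>2) \<le> (dist f g)\<^sup>2" if "finite F" for F f g
      unfolding dist using sum_le_suminf[OF sumdiff[of f g] that] suminf_nonneg[OF sumdiff[of f g]]
      by simp
    have cauchy: "\<exists>M. \<forall>m\<ge>M. \<forall>n\<ge>M. dist (X m) (X n) < e" if "e > 0" for e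
      using \<open>Cauchy X\<close> that unfolding Cauchy_def by blast
    have "Cauchy (\<lambda>k. hcoeff (X k) n)" for n
      unfolding Cauchy_def
    proof (intro allI impI)
      fix e :: real
      assume "e > 0"
      obtain M where M: "\<forall>k\<ge>M. \<forall>l\<ge>M. dist (X k) (X l) < e"
        using cauchy[OF \<open>e > 0\<close>] ..
      have le: "dist (hcoeff f n) (hcoeff g n) \<le> dist f g" for f g
      proof (rule power2_le_imp_le)
        show "(dist (hcoeff f n) (hcoeff g n))\<^sup>2 \<le> (dist f g)\<^sup>2"
          using part[of "{n}" f g] by (simp add: dist_norm[where 'a = complex])
      qed simp
      show "\<exists>M. \<forall>k\<ge>M. \<forall>l\<ge>M. dist (hcoeff (X k) n) (hcoeff (X l) n) < e"
        using M by (intro exI[of _ M] allI impI le_less_trans[OF le]) simp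
    qed
    then have "\<forall>n. \<exists>l. (\<lambda>k. hcoeff (X k) n) \<longlonglongrightarrow> l"
      using Cauchy_convergent convergent_def by blast
    then obtain a where a: "\<And>n. (\<lambda>k. hcoeff (X k) n) \<longlonglongrightarrow> a n"
      by metis
    have close: "\<exists>M. \<forall>m\<ge>M. \<forall>N. (\<Sum>n<N. (cmod (hcoeff (X m) n - a n))\<^sup>2) \<le> e\<^sup>2" if e: "e > 0" for e
    proof -
      obtain M where M: "\<forall>m\<ge>M. \<forall>k\<ge>M. dist (X m) (X k) < e"
        using cauchy[OF e] ..
      have "(\<Sum>n<N. (cmod (hcoeff (X m) n - a n))\<^sup>2) \<le> e\<^sup>2" if m: "m \<ge> M" for m N
      proof (rule tendsto_upperbound)
        show "(\<lambda>k. \<Sum>n<N. (cmod (hcoeff (X m) n - hcoeff (X k) n))\<^sup>2)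
            \<longlonglongrightarrow> (\<Sum>n<N. (cmod (hcoeff (X m) n - a n))\<^sup>2)"
          by (intro tendsto_intros a)
        have "(\<Sum>n<N. (cmod (hcoeff (X m) n - hcoeff (X k) n))\<^sup>2) \<le> e\<^sup>2" if "k \<ge> M" for k
        proof -
          have "(dist (X m) (X k))\<^sup>2 \<le> e\<^sup>2"
            using M m that by (intro power_mono) (simp_all add: less_imp_le)
          then show ?thesis
            using part[of "{..<N}" "X m" "X k"] by simp
        qed
        then show "\<forall>\<^sub>F k in sequentially.
            (\<Sum>n<N. (cmod (hcoeff (X m) n - hcoeff (X k) n))\<^sup>2) \<le> e\<^sup>2"
          by (auto simp: eventually_sequentially)
      qed simp
      then show ?thesis
        by blast
    qed
    have summ: "summable (\<lambda>n. (cmod (hcoeff (X m) n - a n))\<^sup>2)"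
      if "\<forall>N. (\<Sum>n<N. (cmod (hcoeff (X m) n - a n))\<^sup>2) \<le> C" for m C
      by (rule bounded_imp_summable[of _ C])
        (use that in \<open>simp_all only: lessThan_Suc_atMost[symmetric] zero_le_power2\<close>)
    obtain M where "\<forall>m\<ge>M. \<forall>N. (\<Sum>n<N. (cmod (hcoeff (X m) n - a n))\<^sup>2) \<le> 1\<^sup>2"
      using close[OF zero_less_one] by blast
    then have "summable (\<lambda>n. (cmod (hcoeff (X M) n - a n))\<^sup>2)"
      using summ[of M "1\<^sup>2"] by blast
    then have "summable (\<lambda>n. (cmod (- (hcoeff (X M) n - a n) + hcoeff (X M) n))\<^sup>2)"
      by (intro square_summable_add square_summable_hcoeff) (simp only: norm_minus_cancel)
    then obtain F where F: "hcoeff F = a"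
      using ex_hardy_hcoeff[of a] by auto
    have "X \<longlonglongrightarrow> F"
    proof (rule metric_LIMSEQ_I)
      fix e :: real
      assume "e > 0"
      then obtain M where M: "\<forall>m\<ge>M. \<forall>N. (\<Sum>n<N. (cmod (hcoeff (X m) n - a n))\<^sup>2) \<le> (e / 2)\<^sup>2"
        using close[of "e / 2"] half_gt_zero by blast
      have "dist (X m) F < e" if m: "m \<ge> M" for m
      proof -
        have "(\<Sum>n. (cmod (hcoeff (X m) n - hcoeff F n))\<^sup>2) \<le> (e / 2)\<^sup>2"
          using M m by (intro suminf_le_const sumdiff) (auto simp: F)
        then have "dist (X m) F \<le> sqrt ((e / 2)\<^sup>2)"
          unfolding dist by (rule real_sqrt_le_mono)
        then show ?thesis
          using \<open>e > 0\<close> by simp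
      qed
      then show "\<exists>M. \<forall>m\<ge>M. dist (X m) F < e"
        by blast
    qed
    then show ?thesis
      by (rule convergentI)
  qed
qed

instantiation hardy :: complex_hilbert_space
begin

definition scaleC_hardy :: "complex \<Rightarrow> hardy \<Rightarrow> hardy" where
  "c *\<^sub>C f = Abs_hardy (\<lambda>z. c * hardy_fun f z)"

definition cinner_hardy :: "hardy \<Rightarrow> hardy \<Rightarrow> complex" where
  "cinner f g = (\<Sum>n. hcoeff f n * cnj (hcoeff g n))"

lemma hcoeff_scaleC: "hcoeff (c *\<^sub>C f) n = c * hcoeff f n"
  by (simp add: hcoeff_def scaleC_hardy_def Abs_hardy_inverse hardy_functions_mult hardy_fun
      taylor_coeff_mult)

instance
proof
  fix f g h :: hardy and r :: real and c d :: complex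
  show "c *\<^sub>C (f + g) = c *\<^sub>C f + c *\<^sub>C g" "(c + d) *\<^sub>C f = c *\<^sub>C f + d *\<^sub>C f"
    "c *\<^sub>C d *\<^sub>C f = (c * d) *\<^sub>C f" "1 *\<^sub>C f = f"
    by (rule hardy_eqI, rule ext, simp add: hcoeff_simps hcoeff_scaleC algebra_simps)+
  show "r *\<^sub>R f = of_real r *\<^sub>C f"
    by (simp add: scaleR_hardy_def scaleC_hardy_def)
  have "cnj (cinner g f) = (\<Sum>n. cnj (hcoeff g n * cnj (hcoeff f n)))"
    unfolding cinner_hardy_def
    by (rule bounded_linear.suminf[OF bounded_linear_cnj summable_hcoeff_product])
  then show "cinner f g = cnj (cinner g f)"
    by (simp add: cinner_hardy_def mult.commute)
  show "cinner (f + g) h = cinner f h + cinner g h"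
    using suminf_add[OF summable_hcoeff_product[of f h] summable_hcoeff_product[of g h]]
    by (simp add: cinner_hardy_def hcoeff_simps distrib_right)
  show "cinner (c *\<^sub>C f) g = c * cinner f g"
    using suminf_mult[OF summable_hcoeff_product[of f g], of c]
    by (simp add: cinner_hardy_def hcoeff_scaleC mult.assoc)
  show "inner f g = Re (cinner f g)"
    by (simp add: inner_hardy_def cinner_hardy_def)
qed

end

text \<open>
  For an analytic selfmap \<open>\<phi>\<close> of the disk, \<open>f \<circ> \<phi>\<close> lies in the Hardy space again, by Littlewood's
  subordination theorem. The cut-off keeps the representative zero outside the disk.
\<close>

definition composition_operator :: "(complex \<Rightarrow> complex) \<Rightarrow> hardy \<Rightarrow> hardy" where
  "composition_operator \<phi> f =
     Abs_hardy (\<lambda>z. if z \<in> ball 0 1 then hardy_fun f (\<phi> z) else 0)"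

end

(* For a constant map \<phi> = p on the disk, C f = f(p) 1 = \<langle>f, k\<rangle> e is a rank one operator, with
   e = 1 and k the reproducing kernel at p, and its adjoint is g \<mapsto> \<langle>g, e\<rangle> k. Posinormality gives
   e \<in> span k and coposinormality gives k \<in> span e. The first two Taylor coefficients of e are 1, 0 and
   those of k are 1, cnj p, so either condition forces p = 0; and if p = 0, then k = e and C is
   self-adjoint, hence posinormal and coposinormal with P the identity. *)
theory Submission
  imports Defs
begin

text \<open>The real part of \<open>cinner\<close> is the real inner product, which already
  separates points. This supplies uniqueness of adjoints.\<close>

lemma cinner_eqI:
  fixes u v :: "'a::complex_hilbert_space"
  assumes "\<And>x. cinner x u = cinner x v"
  shows "u = v"
  using assms vector_eq_ldot[of u v] by (simp add: inner_eq_Re_cinner)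

lemma cinner_scaleC_right:
  "cinner x (c *\<^sub>C y) = cnj c * cinner x (y::'a::complex_hilbert_space)"
  by (metis cinner_commute cinner_scaleC_left complex_cnj_mult)

lemma cinner_self: "cinner x x = of_real ((norm (x::'a::complex_hilbert_space))\<^sup>2)"
proof (rule complex_eqI)
  show "Re (cinner x x) = Re (of_real ((norm x)\<^sup>2))"
    by (simp flip: inner_eq_Re_cinner add: power2_norm_eq_inner)
  have "Im (cinner x x) = Im (cnj (cinner x x))"
    using cinner_commute[of x x] by simp
  then show "Im (cinner x x) = Im (of_real ((norm x)\<^sup>2))"
    by simp
qed

text \<open>The class provides homogeneity of the norm for real scalars only; the complex case comes
  from comparing squares through \<open>cinner\<close>.\<close>

lemma norm_scaleC: "norm (c *\<^sub>C x) = cmod c * norm (x::'a::complex_hilbert_space)"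
proof -
  have "complex_of_real ((norm (c *\<^sub>C x))\<^sup>2) = c * cnj c * of_real ((norm x)\<^sup>2)"
    unfolding cinner_self[symmetric] by (simp add: cinner_scaleC_left cinner_scaleC_right)
  also have "\<dots> = of_real ((cmod c * norm x)\<^sup>2)"
    by (simp add: complex_mult_cnj cmod_power2 power_mult_distrib)
  finally have "(norm (c *\<^sub>C x))\<^sup>2 = (cmod c * norm x)\<^sup>2"
    by (simp only: of_real_eq_iff)
  then show ?thesis
    by (rule power2_eq_imp_eq) simp_all
qed

lemma norm_cinner_le: "cmod (cinner x y) \<le> norm x * norm (y::'a::complex_hilbert_space)"
proof (cases "cinner x y = 0")
  case False
  let ?c = "cinner x y"
  \<comment> \<open>Multiplying \<open>x\<close> by \<open>cnj ?c\<close> makes the product real and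
    nonnegative, so the real Cauchy-Schwarz inequality applies; one factor \<open>cmod ?c\<close>
    then cancels.\<close>
  have "(cmod ?c)\<^sup>2 = Re (cinner (cnj ?c *\<^sub>C x) y)"
    by (simp add: cinner_scaleC_left cmod_power2 flip: power2_eq_square)
  also have "\<dots> \<le> norm (cnj ?c *\<^sub>C x) * norm y"
    unfolding inner_eq_Re_cinner[symmetric] by (rule norm_cauchy_schwarz)
  finally have "cmod ?c * cmod ?c \<le> cmod ?c * (norm x * norm y)"
    by (simp add: norm_scaleC power2_eq_square mult.assoc)
  then show ?thesis
    using False by simp
qed simp

lemma scaleC_zero_left: "0 *\<^sub>C x = (0::'a::complex_hilbert_space)"
  using norm_scaleC[of 0 x] by simp

lemma cadjoint_eqI:
  assumes "\<And>x y. cinner (A x) y = cinner x (B y)"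
  shows "cadjoint A = B"
  unfolding cadjoint_def
proof (rule the_equality)
  fix B' assume "\<forall>x y. cinner (A x) y = cinner x (B' y)"
  then show "B' = B"
    using assms by (intro ext cinner_eqI) simp
qed (use assms in blast)

lemma positive_operator_id: "positive_operator (id :: 'a::complex_hilbert_space \<Rightarrow> 'a)"
  by (simp add: positive_operator_def bounded_clinear_def bounded_linear_ident id_def cinner_self)

lemma self_adjoint_imp_posinormal: "self_adjoint A \<Longrightarrow> posinormal A"
  unfolding self_adjoint_def posinormal_def
  by (metis comp_id positive_operator_id)

lemma self_adjoint_imp_coposinormal: "self_adjoint A \<Longrightarrow> coposinormal A"
  by (metis coposinormal_def self_adjoint_def self_adjoint_imp_posinormal)

text \<open>\<open>k\<close> represents the functional and \<open>e\<close> spans the range, so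
  taking adjoints swaps these two arguments.\<close>

definition rank_one :: "'a::complex_hilbert_space \<Rightarrow> 'a \<Rightarrow> 'a \<Rightarrow> 'a" where
  "rank_one k e x = cinner x k *\<^sub>C e"

lemma bounded_clinear_rank_one: "bounded_clinear (rank_one k e)"
  unfolding bounded_clinear_def
proof (intro conjI allI)
  show "rank_one k e (c *\<^sub>C x) = c *\<^sub>C rank_one k e x" for c x
    by (simp add: rank_one_def cinner_scaleC_left scaleC_scaleC)
  show "bounded_linear (rank_one k e)"
  proof (rule bounded_linear_intro)
    show "rank_one k e (x + y) = rank_one k e x + rank_one k e y" for x y
      by (simp add: rank_one_def cinner_add_left scaleC_add_left)
    show "rank_one k e (r *\<^sub>R x) = r *\<^sub>R rank_one k e x" for r x
      by (simp add: rank_one_def scaleR_scaleC cinner_scaleC_left scaleC_scaleC)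
    show "norm (rank_one k e x) \<le> norm x * (norm k * norm e)" for x
      using mult_right_mono[OF norm_cinner_le[of x k], of "norm e"]
      by (simp add: rank_one_def norm_scaleC mult.assoc)
  qed
qed

lemma cadjoint_rank_one: "cadjoint (rank_one k e) = rank_one e k"
proof (rule cadjoint_eqI)
  show "cinner (rank_one k e x) y = cinner x (rank_one e k y)" for x y
    using cinner_commute[of e y]
    by (simp add: rank_one_def cinner_scaleC_left cinner_scaleC_right mult.commute)
qed

lemma posinormal_rank_oneD:
  assumes "posinormal (rank_one k e)" and "k \<noteq> 0"
  shows "\<exists>c. e = c *\<^sub>C k"
proof (cases "e = 0")
  case True
  then show ?thesis
    using scaleC_zero_left[of k] by metis
next
  case False
  obtain P where "rank_one k e \<circ> rank_one e k = rank_one e k \<circ> P \<circ> rank_one k e"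
    using assms(1) by (auto simp: posinormal_def cadjoint_rank_one)
  \<comment> \<open>Evaluating at \<open>e\<close> turns the left side into a multiple of
    \<open>e\<close> with factor \<open>cinner e e * cinner k k\<close>, while the right side lies
    in the span of \<open>k\<close> whatever \<open>P\<close> does. The factor is nonzero and can be
    inverted.\<close>
  then have "rank_one k e (rank_one e k e) = rank_one e k (P (rank_one k e e))"
    by (metis comp_apply)
  then have "\<exists>d. (cinner e e * cinner k k) *\<^sub>C e = d *\<^sub>C k"
    by (auto simp: rank_one_def cinner_scaleC_left)
  then obtain d where d: "(cinner e e * cinner k k) *\<^sub>C e = d *\<^sub>C k" ..
  let ?a = "cinner e e * cinner k k"
  have "?a \<noteq> 0"
    using False assms(2) by (simp add: cinner_self)
  then have "e = inverse ?a *\<^sub>C ?a *\<^sub>C e"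
    by (simp only: scaleC_scaleC left_inverse scaleC_one not_False_eq_True)
  then show ?thesis
    unfolding d scaleC_scaleC by blast
qed

text \<open>Since \<open>0 ^ 0 = 1\<close>, these are the coefficients of the constant function 1,
  in the form of a kernel at 0.\<close>

definition hardy_one :: hardy where
  "hardy_one = Abs_hardy (power_series_on_disk (\<lambda>n. 0 ^ n))"

text \<open>For \<open>p\<close> in the disk this is the Szego kernel 1 / (1 - \<open>cnj p\<close>
  z); the conjugate offsets the one in the second argument of \<open>cinner\<close>.\<close>

definition hardy_kernel :: "complex \<Rightarrow> hardy" where
  "hardy_kernel p = Abs_hardy (power_series_on_disk (\<lambda>n. cnj p ^ n))"

lemma hardy_one_eq_kernel: "hardy_one = hardy_kernel 0"
  by (simp add: hardy_one_def hardy_kernel_def)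

lemma hcoeff_hardy_kernel:
  assumes "p \<in> ball 0 1"
  shows "hcoeff (hardy_kernel p) n = cnj p ^ n"
proof -
  have "summable (\<lambda>n. ((cmod p)\<^sup>2) ^ n)"
    using assms by (intro summable_geometric) (simp add: power_less_one_iff)
  then have "summable (\<lambda>n. (cmod (cnj p ^ n))\<^sup>2)"
    by (simp add: norm_power mult.commute flip: power_mult)
  from square_summable_power_series[OF this] show ?thesis
    by (simp add: hcoeff_def hardy_kernel_def Abs_hardy_inverse)
qed

lemma hardy_fun_one: "hardy_fun hardy_one z = (if z \<in> ball 0 1 then 1 else 0)"
proof -
  have "summable (\<lambda>n. (cmod (0 ^ n))\<^sup>2)"
    by (rule summable_finite[of "{0}"]) (auto simp: power_0_left)
  moreover have "(\<Sum>n. 0 ^ n * z ^ n) = 1"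
    by (simp add: suminf_geometric flip: power_mult_distrib)
  ultimately show ?thesis
    by (simp add: hardy_one_def Abs_hardy_inverse square_summable_power_series(1)
        power_series_on_disk_def)
qed

text \<open>The Taylor series of \<open>f\<close> at \<open>p\<close> is term by term the series
  defining the inner product.\<close>

lemma hardy_fun_eq_cinner_kernel:
  assumes "p \<in> ball 0 1"
  shows "hardy_fun f p = cinner f (hardy_kernel p)"
proof -
  have "hardy_fun f holomorphic_on ball 0 1"
    using hardy_fun[of f] by (simp add: hardy_functions_def)
  from holomorphic_power_series[OF this assms]
  have "(\<lambda>n. hcoeff f n * p ^ n) sums hardy_fun f p"
    by (simp add: hcoeff_def taylor_coeff_def)
  then show ?thesis
    by (simp add: cinner_hardy_def hcoeff_hardy_kernel[OF assms] sums_iff)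
qed

lemma composition_operator_constant:
  assumes "p \<in> ball 0 1" and "\<And>z. z \<in> ball 0 1 \<Longrightarrow> \<phi> z = p"
  shows "composition_operator \<phi> = rank_one (hardy_kernel p) hardy_one"
proof
  fix f
  \<comment> \<open>The cut-off is absorbed by the representative of \<open>hardy_one\<close>, which
    also vanishes off the disk.\<close>
  have "(\<lambda>z. if z \<in> ball 0 1 then hardy_fun f (\<phi> z) else 0)
      = (\<lambda>z. hardy_fun f p * hardy_fun hardy_one z)"
    using assms(2) by (auto simp: hardy_fun_one)
  then show "composition_operator \<phi> f = rank_one (hardy_kernel p) hardy_one f"
    by (simp only: composition_operator_def rank_one_def scaleC_hardy_def
        hardy_fun_eq_cinner_kernel[OF assms(1)])
qed

lemma hardy_kernel_nonzero: "p \<in> ball 0 1 \<Longrightarrow> hardy_kernel p \<noteq> 0"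
  using hcoeff_hardy_kernel[of p 0] by (auto simp: hcoeff_zero)

lemma hardy_kernel_eq_scaleC_imp:
  assumes "p \<in> ball 0 1" "q \<in> ball 0 1" and "hardy_kernel p = c *\<^sub>C hardy_kernel q"
  shows "p = q"
proof -
  have "cnj p ^ n = c * cnj q ^ n" for n
    using assms hcoeff_hardy_kernel hcoeff_scaleC by metis
  \<comment> \<open>Index 0 forces \<open>c = 1\<close>; index 1 then compares the points.\<close>
  from this[of 0] this[of 1] show ?thesis
    by simp
qed

theorem proposition1p5:
  fixes \<phi> :: "complex \<Rightarrow> complex"
  assumes "\<phi> \<in> ball 0 1 \<rightarrow> ball 0 1"
    and "\<phi> constant_on ball 0 1"
  shows "(posinormal (composition_operator \<phi>) \<longleftrightarrow> coposinormal (composition_operator \<phi>)) \<and>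
    (coposinormal (composition_operator \<phi>) \<longleftrightarrow> self_adjoint (composition_operator \<phi>)) \<and>
    (self_adjoint (composition_operator \<phi>) \<longleftrightarrow> (\<forall>z\<in>ball 0 1. \<phi> z = 0))"
proof -
  obtain p where const: "\<And>z. z \<in> ball 0 1 \<Longrightarrow> \<phi> z = p"
    using assms(2) by (auto simp: constant_on_def)
  have zero_mem: "(0::complex) \<in> ball 0 1"
    by simp
  have p: "p \<in> ball 0 1"
    using assms(1) const[OF zero_mem] zero_mem by (metis PiE)
  have zero_iff: "(\<forall>z\<in>ball 0 1. \<phi> z = 0) \<longleftrightarrow> p = 0"
    using const zero_mem by metis
  \<comment> \<open>With 1 written as the kernel at 0, passing to the adjoint merely exchanges 0 and
    \<open>p\<close>, so the same two lemmas serve both implications.\<close>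
  have C: "composition_operator \<phi> = rank_one (hardy_kernel p) (hardy_kernel 0)"
    using composition_operator_constant[OF p const] by (simp only: hardy_one_eq_kernel)
  have "p = 0" if "posinormal (composition_operator \<phi>)"
    using posinormal_rank_oneD[of "hardy_kernel p" "hardy_kernel 0"] that
      hardy_kernel_nonzero[OF p] hardy_kernel_eq_scaleC_imp[OF zero_mem p]
    by (auto simp: C)
  moreover have "p = 0" if "coposinormal (composition_operator \<phi>)"
    using posinormal_rank_oneD[of "hardy_kernel 0" "hardy_kernel p"] that
      hardy_kernel_nonzero[OF zero_mem] hardy_kernel_eq_scaleC_imp[OF p zero_mem]
    by (auto simp: C coposinormal_def cadjoint_rank_one)
  moreover have "self_adjoint (composition_operator \<phi>)" if "p = 0"
    using that by (simp add: C self_adjoint_def bounded_clinear_rank_one cadjoint_rank_one)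
  ultimately show ?thesis
    using self_adjoint_imp_posinormal self_adjoint_imp_coposinormal zero_iff by blast
qed

end
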